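(* Let $m$ be even and $q$ be odd positive integers, and let $L$ be a $q$-step type Latin square of order $n=mq$ in which the $q\times q$ Latin subsquares (blocks) are cyclic. Then $L$ has a $2$-transversal.
   Context: A Latin square of order $N$ is an $N\times N$ array with entries from an $N$-element symbol set such that no symbol appears twice in any row or column. A cyclic Latin square is a Latin square in which each column is obtained from the previous one by adding the same difference to each element of the previous column. A Latin square of order $mq$ is of $q$-step type if it can be represented as an $m\times m$ matrix of $q\times q$ blocks $A_{ij}$, where each block is a Latin subsquare of order $q$, and two blocks $A_{ij}$ and $A_{i'j'}$ contain the same symbols if and only if $i+j\equiv i'+j'\pmod m$. For a positive integer $k$, a $k$-transversal ($k$-plex) in a Latin square of order $n$ is a set of $nk$ cells containing exactly $k$ cells from each row and $k$ cells from each column, in which every symbol occurs exactly $k$ times. *)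

theory Defs
  imports "HOL-Number_Theory.Cong"
begin

text \<open>Arrays are functions of a row and a column index, both counted from 0; only indices below
  the order are relevant.\<close>

definition latin_square :: "'a set \<Rightarrow> nat \<Rightarrow> (nat \<Rightarrow> nat \<Rightarrow> 'a) \<Rightarrow> bool" where
  "latin_square S N L \<longleftrightarrow>
     finite S \<and> card S = N \<and>
     (\<forall>i<N. \<forall>j<N. L i j \<in> S) \<and>
     (\<forall>i<N. inj_on (\<lambda>j. L i j) {..<N}) \<and>
     (\<forall>j<N. inj_on (\<lambda>i. L i j) {..<N})"

text \<open>To add a difference to a symbol, the symbols have to be identified with the integers
  modulo \<open>N\<close>; the numbering \<open>\<nu>\<close> does this. The difference is the same for all
  elements of a column and may depend on the column, so squares with one common difference for
  all columns are included.\<close>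

definition cyclic_latin_square :: "'a set \<Rightarrow> nat \<Rightarrow> (nat \<Rightarrow> nat \<Rightarrow> 'a) \<Rightarrow> bool" where
  "cyclic_latin_square S N L \<longleftrightarrow>
     latin_square S N L \<and>
     (\<exists>\<nu>. bij_betw \<nu> S {..<N} \<and>
       (\<forall>j. Suc j < N \<longrightarrow>
         (\<exists>d::nat. \<forall>i<N. [\<nu> (L i (Suc j)) = \<nu> (L i j) + d] (mod N))))"

definition block :: "nat \<Rightarrow> (nat \<Rightarrow> nat \<Rightarrow> 'a) \<Rightarrow> nat \<Rightarrow> nat \<Rightarrow> (nat \<Rightarrow> nat \<Rightarrow> 'a)" where
  "block q L a b = (\<lambda>i j. L (a * q + i) (b * q + j))"

definition symbols :: "nat \<Rightarrow> (nat \<Rightarrow> nat \<Rightarrow> 'a) \<Rightarrow> 'a set" where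
  "symbols N A = {A i j | i j. i < N \<and> j < N}"

definition q_step_type :: "'a set \<Rightarrow> nat \<Rightarrow> nat \<Rightarrow> (nat \<Rightarrow> nat \<Rightarrow> 'a) \<Rightarrow> bool" where
  "q_step_type S m q L \<longleftrightarrow>
     latin_square S (m * q) L \<and>
     (\<forall>a<m. \<forall>b<m. latin_square (symbols q (block q L a b)) q (block q L a b)) \<and>
     (\<forall>a<m. \<forall>b<m. \<forall>a'<m. \<forall>b'<m.
        symbols q (block q L a b) = symbols q (block q L a' b') \<longleftrightarrow>
        [a + b = a' + b'] (mod m))"

definition k_transversal ::
    "'a set \<Rightarrow> nat \<Rightarrow> (nat \<Rightarrow> nat \<Rightarrow> 'a) \<Rightarrow> nat \<Rightarrow> (nat \<times> nat) set \<Rightarrow> bool" where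
  "k_transversal S N L k T \<longleftrightarrow>
     T \<subseteq> {..<N} \<times> {..<N} \<and> card T = N * k \<and>
     (\<forall>i<N. card {p \<in> T. fst p = i} = k) \<and>
     (\<forall>j<N. card {p \<in> T. snd p = j} = k) \<and>
     (\<forall>s\<in>S. card {p \<in> T. L (fst p) (snd p) = s} = k)"

end

(* In the array of blocks, which is the addition table of the integers modulo m, the cells (i, i)
   and (i, i + 1) form a 2-transversal when m is even: the former contain every even symbol twice,
   the latter every odd symbol twice. A cyclic Latin square of odd order q is isotopic to the
   addition table of the integers modulo q, whose main diagonal is a transversal because 2 is
   invertible modulo q. Replacing each chosen cell of the block array by a transversal of the
   corresponding block gives the required 2-transversal. *)
theory Submission imports Defs begin

section \<open>Rows, columns and fibres as bijections\<close>

lemma latin_square_row_bij: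
  assumes "latin_square S N L" "i < N"
  shows "bij_betw (\<lambda>j. L i j) {..<N} S"
proof -
  have "inj_on (\<lambda>j. L i j) {..<N}" "(\<lambda>j. L i j) ` {..<N} \<subseteq> S" "finite S" "card S = N"
    using assms by (auto simp: latin_square_def)
  then show ?thesis
    by (simp add: bij_betw_def card_image card_subset_eq)
qed

lemma latin_square_transpose: "latin_square S N (\<lambda>i j. L j i) \<longleftrightarrow> latin_square S N L"
  unfolding latin_square_def by blast

lemma latin_square_col_bij:
  assumes "latin_square S N L" "j < N"
  shows "bij_betw (\<lambda>i. L i j) {..<N} S"
  using latin_square_row_bij[OF iffD2[OF latin_square_transpose assms(1)] assms(2)] .

text \<open>This treats rows, columns and symbols of a parametrised set of cells alike, with
  \<open>f\<close> the coordinate or the entry of a cell. Injectivity of \<open>h\<close> is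
  implied, because \<open>f\<close> composed with \<open>h\<close> is injective on
  \<open>A\<close>.\<close>

lemma card_fibre_image:
  assumes "bij_betw (\<lambda>x. f (h x)) A B" "s \<in> B"
  shows "card {p \<in> h ` A. f p = s} = 1"
proof -
  obtain x where x: "x \<in> A" "f (h x) = s"
    using assms by (auto simp: bij_betw_def)
  have "{p \<in> h ` A. f p = s} = {h x}"
    using x assms(1) by (auto simp: bij_betw_def dest: inj_onD)
  then show ?thesis by simp
qed

section \<open>Transversals of cyclic Latin squares of odd order\<close>

text \<open>Summing the differences of the first \<open>j\<close> steps shows that passing from
  column 0 to column \<open>j\<close> adds the same amount in row \<open>i\<close> as in row 0. The
  additive form avoids truncated subtraction on the naturals.\<close>

lemma cyclic_latin_square_isotopic:
  assumes shift: "\<And>j. Suc j < N \<Longrightarrow> \<exists>d::nat. \<forall>i<N. [\<nu> (L i (Suc j)) = \<nu> (L i j) + d] (mod N)"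
    and "i < N" "j < N"
  shows "[\<nu> (L i j) + \<nu> (L 0 0) = \<nu> (L i 0) + \<nu> (L 0 j)] (mod N)"
  using \<open>j < N\<close>
proof (induction j)
  case (Suc j)
  obtain d where d: "\<And>i. i < N \<Longrightarrow> [\<nu> (L i (Suc j)) = \<nu> (L i j) + d] (mod N)"
    using shift Suc.prems by blast
  have "[\<nu> (L i (Suc j)) + \<nu> (L 0 0) = (\<nu> (L i j) + d) + \<nu> (L 0 0)] (mod N)"
    by (rule cong_add[OF d[OF \<open>i < N\<close>] cong_refl])
  also have "(\<nu> (L i j) + d) + \<nu> (L 0 0) = (\<nu> (L i j) + \<nu> (L 0 0)) + d"
    by simp
  also have "[\<dots> = (\<nu> (L i 0) + \<nu> (L 0 j)) + d] (mod N)"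
    by (rule cong_add[OF Suc.IH[OF Suc_lessD[OF Suc.prems]] cong_refl])
  also have "(\<nu> (L i 0) + \<nu> (L 0 j)) + d = \<nu> (L i 0) + (\<nu> (L 0 j) + d)"
    by simp
  also have "[\<dots> = \<nu> (L i 0) + \<nu> (L 0 (Suc j))] (mod N)"
    by (rule cong_add[OF cong_refl cong_sym[OF d]]) (use Suc.prems in simp)
  finally show ?case .
qed (simp add: cong_def)

lemma odd_cyclic_latin_square_transversal:
  assumes "cyclic_latin_square S N L" "odd N"
  shows "\<exists>T. k_transversal S N L 1 T"
proof -
  have "N > 0" using \<open>odd N\<close> by (rule odd_pos)
  have latin: "latin_square S N L"
    using assms(1) by (simp add: cyclic_latin_square_def)
  obtain \<nu> where \<nu>: "bij_betw \<nu> S {..<N}"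
    and shift: "\<And>j. Suc j < N \<Longrightarrow> \<exists>d::nat. \<forall>i<N. [\<nu> (L i (Suc j)) = \<nu> (L i j) + d] (mod N)"
    using assms(1) unfolding cyclic_latin_square_def by blast
  have col: "bij_betw (\<lambda>i. \<nu> (L i 0)) {..<N} {..<N}"
    using bij_betw_trans[OF latin_square_col_bij[OF latin \<open>N > 0\<close>] \<nu>] by (simp add: comp_def)
  have row: "bij_betw (\<lambda>j. \<nu> (L 0 j)) {..<N} {..<N}"
    using bij_betw_trans[OF latin_square_row_bij[OF latin \<open>N > 0\<close>] \<nu>] by (simp add: comp_def)
  \<comment> \<open>These permutations sort column 0 and row 0: \<open>r x\<close> is the row whose
    entry in column 0 has number \<open>x\<close>, and \<open>c x\<close> is the column whose entry
    in row 0 has number \<open>x\<close>.\<close>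
  define r where "r = inv_into {..<N} (\<lambda>i. \<nu> (L i 0))"
  define c where "c = inv_into {..<N} (\<lambda>j. \<nu> (L 0 j))"
  have r: "bij_betw r {..<N} {..<N}" "\<And>x. x < N \<Longrightarrow> \<nu> (L (r x) 0) = x"
    using bij_betw_inv_into[OF col] bij_betw_inv_into_right[OF col] by (simp_all add: r_def)
  have c: "bij_betw c {..<N} {..<N}" "\<And>x. x < N \<Longrightarrow> \<nu> (L 0 (c x)) = x"
    using bij_betw_inv_into[OF row] bij_betw_inv_into_right[OF row] by (simp_all add: c_def)
  have lt: "r x < N" "c x < N" if "x < N" for x
    using r(1) c(1) that by (auto simp: bij_betw_def)
  \<comment> \<open>In the sorted order the square is an addition table up to the constant
    \<open>\<nu> (L 0 0)\<close>, so its diagonal carries the doubles shifted by that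
    constant.\<close>
  have double: "[\<nu> (L (r x) (c x)) + \<nu> (L 0 0) = 2 * x] (mod N)" if "x < N" for x
    using cyclic_latin_square_isotopic[of N \<nu> L, OF shift lt[OF that]] r(2) c(2) that
    by (simp add: mult_2)
  have "inj_on (\<lambda>x. L (r x) (c x)) {..<N}"
  proof (rule inj_onI)
    fix x y assume xy: "x \<in> {..<N}" "y \<in> {..<N}" "L (r x) (c x) = L (r y) (c y)"
    then have "[2 * x = 2 * y] (mod N)"
      using double[of x] double[of y] by (auto simp: cong_def)
    then have "[x = y] (mod N)"
      using \<open>odd N\<close> by (subst (asm) cong_mult_lcancel_nat) auto
    then show "x = y"
      using xy by (auto intro: cong_less_modulus_unique_nat)
  qed
  moreover have "(\<lambda>x. L (r x) (c x)) ` {..<N} \<subseteq> S" "finite S" "card S = N"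
    using latin lt by (auto simp: latin_square_def)
  ultimately have sym: "bij_betw (\<lambda>x. L (r x) (c x)) {..<N} S"
    by (simp add: bij_betw_def card_image card_subset_eq)
  define h where "h = (\<lambda>x. (r x, c x))"
  have "inj_on h {..<N}"
    using r(1) by (auto simp: h_def bij_betw_def inj_on_def)
  then have "card (h ` {..<N}) = N * 1"
    by (simp add: card_image)
  moreover have "h ` {..<N} \<subseteq> {..<N} \<times> {..<N}"
    using lt by (auto simp: h_def)
  moreover have "card {p \<in> h ` {..<N}. fst p = i} = 1" if "i < N" for i
    using r(1) that by (intro card_fibre_image[where B = "{..<N}"]) (simp_all add: h_def)
  moreover have "card {p \<in> h ` {..<N}. snd p = j} = 1" if "j < N" for j
    using c(1) that by (intro card_fibre_image[where B = "{..<N}"]) (simp_all add: h_def)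
  moreover have "card {p \<in> h ` {..<N}. L (fst p) (snd p) = s} = 1" if "s \<in> S" for s
    using sym that by (intro card_fibre_image[where B = S]) (simp_all add: h_def)
  ultimately have "k_transversal S N L 1 (h ` {..<N})"
    unfolding k_transversal_def by blast
  then show ?thesis ..
qed

section \<open>A 2-transversal of the addition table modulo an even number\<close>

text \<open>With \<open>m = 2 * h\<close>, the entries of the two diagonals in row \<open>a\<close>
  are \<open>2 * (a mod h)\<close> and \<open>2 * (a mod h) + 1\<close>. Each value taken on a
  diagonal therefore comes from exactly two rows, which differ by \<open>h\<close>.\<close>

lemma even_addition_table_2_transversal:
  assumes "even m" "m > 0"
  shows "\<exists>P. k_transversal {..<m} m (\<lambda>a b. (a + b) mod m) 2 P"
proof -
  obtain h where m: "m = 2 * h" using \<open>even m\<close> by blast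
  have "h > 0" using \<open>m > 0\<close> m by simp
  define suc where "suc a = (if Suc a = m then 0 else Suc a)" for a
  define P where "P = (\<lambda>a. (a, a)) ` {..<m} \<union> (\<lambda>a. (a, suc a)) ` {..<m}"
  \<comment> \<open>Evenness excludes \<open>m = 1\<close>, where the cyclic successor of 0 would be
    0 and the two diagonals would coincide.\<close>
  have suc: "suc a < m" "suc a \<noteq> a" if "a < m" for a
    using that m by (cases "a = 0"; auto simp: suc_def)+
  have fin: "P \<subseteq> {..<m} \<times> {..<m}"
    using suc by (auto simp: P_def)
  have "card P = m + m"
    unfolding P_def
    by (subst card_Un_disjoint) (auto simp: card_image inj_on_def dest: suc(2))
  moreover have "card {p \<in> P. fst p = i} = 2" if "i < m" for i
  proof -
    have "{p \<in> P. fst p = i} = {(i, i), (i, suc i)}"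
      using that by (auto simp: P_def)
    then show ?thesis using suc(2)[OF that] by auto
  qed
  moreover have "card {p \<in> P. snd p = j} = 2" if "j < m" for j
  proof -
    \<comment> \<open>This is the cyclic predecessor of \<open>j\<close>, the only row whose second
      cell lies in column \<open>j\<close>.\<close>
    define j' where "j' = (if j = 0 then m - 1 else j - 1)"
    have j': "j' < m" "\<And>a. a < m \<Longrightarrow> suc a = j \<longleftrightarrow> a = j'"
      using that by (auto simp: suc_def j'_def)
    have "{p \<in> P. snd p = j} = (\<lambda>a. (a, j)) ` {a. a < m \<and> (a = j \<or> suc a = j)}"
      by (auto simp: P_def)
    also have "{a. a < m \<and> (a = j \<or> suc a = j)} = {j, j'}"
      using that j' by blast
    finally have "{p \<in> P. snd p = j} = {(j, j), (j', j)}"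
      by simp
    moreover have "j' \<noteq> j" using j' suc(2) by blast
    ultimately show ?thesis by simp
  qed
  moreover have "card {p \<in> P. (fst p + snd p) mod m = s} = 2" if "s < m" for s
  proof -
    \<comment> \<open>Since \<open>s < m\<close>, the number \<open>s div 2\<close> is below
      \<open>h\<close>, so it is the residue modulo \<open>h\<close> of exactly two numbers below
      \<open>m\<close>.\<close>
    have half: "a mod h = s div 2 \<longleftrightarrow> a = s div 2 \<or> a = s div 2 + h" if "a < m" for a
    proof (cases "a < h")
      case False
      then have "a mod h = a - h"
        using that m by (simp add: mod_if)
      then show ?thesis using False \<open>s < m\<close> m by auto
    qed (use \<open>s < m\<close> m in auto)
    have diag: "(a + a) mod m = 2 * (a mod h)" for a
      unfolding m by (simp add: mult_2[symmetric])
    have "(a + suc a) mod m = Suc (a + a) mod m" if "a < m" for a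
    proof -
      have "suc a = Suc a mod m" using that by (auto simp: suc_def)
      then show ?thesis by (simp add: mod_simps)
    qed
    moreover have "Suc (a + a) mod m = Suc (2 * (a mod h))" for a
    proof -
      \<comment> \<open>The even residue is at most \<open>m - 2\<close>, so adding 1 does not wrap
        around.\<close>
      have "Suc (2 * (a mod h)) < m"
        using mod_less_divisor[OF \<open>h > 0\<close>, of a] m by linarith
      then show ?thesis using diag[of a] by (simp add: mod_Suc)
    qed
    ultimately have off: "(a + suc a) mod m = Suc (2 * (a mod h))" if "a < m" for a
      using that by simp
    have "s div 2 < m" "s div 2 + h < m"
      using \<open>s < m\<close> m by auto
    then have half_set: "{a. a < m \<and> a mod h = s div 2} = {s div 2, s div 2 + h}"
      using half by blast
    have "{p \<in> P. (fst p + snd p) mod m = s} =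
        (\<lambda>a. (a, a)) ` {a \<in> {..<m}. (a + a) mod m = s} \<union>
        (\<lambda>a. (a, suc a)) ` {a \<in> {..<m}. (a + suc a) mod m = s}"
      unfolding P_def by fastforce
    also have "{a \<in> {..<m}. (a + a) mod m = s} = {a \<in> {..<m}. 2 * (a mod h) = s}"
      unfolding diag ..
    also have "{a \<in> {..<m}. (a + suc a) mod m = s} = {a \<in> {..<m}. Suc (2 * (a mod h)) = s}"
      by (intro Collect_cong conj_cong refl) (simp only: off lessThan_iff)
    finally have split: "{p \<in> P. (fst p + snd p) mod m = s} =
        (\<lambda>a. (a, a)) ` {a \<in> {..<m}. 2 * (a mod h) = s} \<union>
        (\<lambda>a. (a, suc a)) ` {a \<in> {..<m}. Suc (2 * (a mod h)) = s}" .
    show ?thesis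
    \<comment> \<open>The parity of \<open>s\<close> decides which diagonal carries it; the other
      one contributes the empty set.\<close>
    proof (cases "even s")
      case True
      then have "2 * x = s \<longleftrightarrow> x = s div 2" "Suc (2 * x) \<noteq> s" for x
        by presburger+
      then show ?thesis using \<open>h > 0\<close> by (simp add: split half_set)
    next
      case False
      then have "2 * x \<noteq> s" "Suc (2 * x) = s \<longleftrightarrow> x = s div 2" for x
        by presburger+
      then show ?thesis using \<open>h > 0\<close> by (simp add: split half_set)
    qed
  qed
  ultimately have "k_transversal {..<m} m (\<lambda>a b. (a + b) mod m) 2 P"
    using fin unfolding k_transversal_def by simp
  then show ?thesis ..
qed

section \<open>Inflating transversals in squares of step type\<close>

text \<open>Row 0 of \<open>L\<close> contains \<open>s\<close> exactly once, so exactly one block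
  \<open>(0, c)\<close> contains it. Any block \<open>(a, b)\<close> has the same symbols as the
  block \<open>(0, (a + b) mod m)\<close>.\<close>

lemma q_step_type_symbol_class:
  assumes "q_step_type S m q L" "s \<in> S"
  obtains c where "c < m"
    and "\<And>a b. a < m \<Longrightarrow> b < m \<Longrightarrow> s \<in> symbols q (block q L a b) \<longleftrightarrow> (a + b) mod m = c"
proof -
  have latin: "latin_square S (m * q) L"
    and blocks: "\<And>a b. a < m \<Longrightarrow> b < m \<Longrightarrow> latin_square (symbols q (block q L a b)) q (block q L a b)"
    and eq: "\<And>a b a' b'. a < m \<Longrightarrow> b < m \<Longrightarrow> a' < m \<Longrightarrow> b' < m \<Longrightarrow>
        symbols q (block q L a b) = symbols q (block q L a' b') \<longleftrightarrow> [a + b = a' + b'] (mod m)"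
    using assms(1) unfolding q_step_type_def by blast+
  have "m * q > 0"
    using latin \<open>s \<in> S\<close> by (metis card_gt_0_iff empty_iff latin_square_def)
  then have "m > 0" "q > 0" by auto
  obtain j where j: "j < m * q" "L 0 j = s"
    using latin_square_row_bij[OF latin \<open>m * q > 0\<close>] \<open>s \<in> S\<close> by (auto simp: bij_betw_def)
  define c where "c = j div q"
  have "c < m"
    using j(1) by (simp add: c_def less_mult_imp_div_less)
  have "s = block q L 0 c 0 (j mod q)"
    using j(2) by (simp add: block_def c_def)
  then have s: "s \<in> symbols q (block q L 0 c)"
    using \<open>q > 0\<close> mod_less_divisor[OF \<open>q > 0\<close>] unfolding symbols_def by blast
  \<comment> \<open>A Latin block shows all its symbols in its first row, which is part of row 0 of
    \<open>L\<close>. A second block with \<open>s\<close> would thus repeat \<open>s\<close> in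
    that row.\<close>
  have "c' = c" if c': "c' < m" "s \<in> symbols q (block q L 0 c')" for c'
  proof -
    have "s \<in> (\<lambda>j. L 0 (c' * q + j)) ` {..<q}"
      using latin_square_row_bij[OF blocks[OF \<open>m > 0\<close> c'(1)] \<open>q > 0\<close>] c'(2)
      by (simp add: bij_betw_def block_def)
    then obtain j' where j': "j' < q" "L 0 (c' * q + j') = s" by blast
    have "c' * q + j' < Suc c' * q" using j'(1) by simp
    also have "\<dots> \<le> m * q" using c'(1) by (intro mult_right_mono) auto
    finally have "c' * q + j' = j"
      using latin_square_row_bij[OF latin \<open>m * q > 0\<close>] j j'(2)
      by (auto simp: bij_betw_def dest: inj_onD)
    then show "c' = c" using j'(1) by (auto simp: c_def)
  qed
  moreover have "symbols q (block q L a b) = symbols q (block q L 0 ((a + b) mod m))"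
    if "a < m" "b < m" for a b
    using eq[OF that \<open>m > 0\<close>] \<open>m > 0\<close> by (simp add: cong_def)
  ultimately show thesis
    using that[OF \<open>c < m\<close>] s \<open>m > 0\<close> by (metis mod_less_divisor)
qed

text \<open>Every \<open>p\<close> that passes \<open>A\<close> contributes a fibre of one element.
  Such a fibre is finite because its cardinality is positive, so no finiteness of \<open>t p\<close>
  is assumed.\<close>

lemma card_Sigma_filter:
  assumes "finite P" "\<And>p. p \<in> P \<Longrightarrow> A p \<Longrightarrow> card {x \<in> t p. B p x} = 1"
  shows "card {z \<in> Sigma P t. A (fst z) \<and> B (fst z) (snd z)} = card {p \<in> P. A p}"
proof -
  have "{z \<in> Sigma P t. A (fst z) \<and> B (fst z) (snd z)} = Sigma {p \<in> P. A p} (\<lambda>p. {x \<in> t p. B p x})"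
    by auto
  also have "card \<dots> = (\<Sum>p\<in>{p \<in> P. A p}. card {x \<in> t p. B p x})"
  proof (rule card_SigmaI)
    show "\<forall>p\<in>{p \<in> P. A p}. finite {x \<in> t p. B p x}"
      using assms(2) by (auto intro!: card_ge_0_finite)
  qed (use assms(1) in simp)
  also have "\<dots> = card {p \<in> P. A p}"
    using assms(2) by simp
  finally show ?thesis .
qed

text \<open>Each condition on a row, column or symbol of \<open>L\<close> splits into a condition on
  the block, met by \<open>k\<close> cells of \<open>P\<close>, and one on the position inside the
  block, met once by the transversal chosen there.\<close>

lemma q_step_type_inflate_transversal:
  assumes step: "q_step_type S m q L"
    and P: "k_transversal {..<m} m (\<lambda>a b. (a + b) mod m) k P"
    and t: "\<And>a b. a < m \<Longrightarrow> b < m \<Longrightarrow>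
      k_transversal (symbols q (block q L a b)) q (block q L a b) 1 (t (a, b))"
  shows "\<exists>T. k_transversal S (m * q) L k T"
proof -
  define \<phi> where "\<phi> = (\<lambda>((a, b), (i, j)). (a * q + i, b * q + j))"
  define Z where "Z = Sigma P t"
  have P_sub: "P \<subseteq> {..<m} \<times> {..<m}" and card_P: "card P = m * k"
    using P by (auto simp: k_transversal_def)
  have "finite P" using P_sub finite_subset by blast
  have t_sub: "t p \<subseteq> {..<q} \<times> {..<q}" and card_t: "card (t p) = q"
    and t_row: "\<And>i. i < q \<Longrightarrow> card {x \<in> t p. fst x = i} = 1"
    and t_col: "\<And>j. j < q \<Longrightarrow> card {x \<in> t p. snd x = j} = 1"
    and t_sym: "\<And>s. s \<in> symbols q (block q L (fst p) (snd p)) \<Longrightarrow>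
        card {x \<in> t p. block q L (fst p) (snd p) (fst x) (snd x) = s} = 1"
    if "p \<in> P" for p
  proof -
    have "fst p < m" "snd p < m" using P_sub that by auto
    then have "k_transversal (symbols q (block q L (fst p) (snd p))) q (block q L (fst p) (snd p)) 1 (t p)"
      using t[of "fst p" "snd p"] by simp
    then show "t p \<subseteq> {..<q} \<times> {..<q}" "card (t p) = q"
      "\<And>i. i < q \<Longrightarrow> card {x \<in> t p. fst x = i} = 1"
      "\<And>j. j < q \<Longrightarrow> card {x \<in> t p. snd x = j} = 1"
      "\<And>s. s \<in> symbols q (block q L (fst p) (snd p)) \<Longrightarrow>
        card {x \<in> t p. block q L (fst p) (snd p) (fst x) (snd x) = s} = 1"
      unfolding k_transversal_def by simp_all
  qed
  \<comment> \<open>Inner coordinates are below \<open>q\<close>, so division with remainder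
    recovers the block and the position in it from a cell of \<open>L\<close>.\<close>
  have decode: "fst (\<phi> z) div q = fst (fst z)" "fst (\<phi> z) mod q = fst (snd z)"
      "snd (\<phi> z) div q = snd (fst z)" "snd (\<phi> z) mod q = snd (snd z)" if "z \<in> Z" for z
    using that t_sub by (fastforce simp: Z_def \<phi>_def)+
  have "inj_on \<phi> Z"
    by (rule inj_onI) (metis decode prod.expand)
  \<comment> \<open>The common pattern of the three counts below: \<open>A\<close> is the part of
    \<open>Q\<close> that selects blocks, \<open>B\<close> the part that selects a cell in a
    block.\<close>
  have fibre: "card {p \<in> \<phi> ` Z. Q p} = card {p \<in> P. A p}"
    if "\<And>z. z \<in> Z \<Longrightarrow> Q (\<phi> z) \<longleftrightarrow> A (fst z) \<and> B (fst z) (snd z)"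
      and "\<And>p. p \<in> P \<Longrightarrow> A p \<Longrightarrow> card {x \<in> t p. B p x} = 1" for Q A B
  proof -
    have "{p \<in> \<phi> ` Z. Q p} = \<phi> ` {z \<in> Z. A (fst z) \<and> B (fst z) (snd z)}"
      using that(1) by blast
    also have "card \<dots> = card {z \<in> Z. A (fst z) \<and> B (fst z) (snd z)}"
      using \<open>inj_on \<phi> Z\<close> by (intro card_image) (auto simp: inj_on_def)
    finally show ?thesis
      using card_Sigma_filter[OF \<open>finite P\<close>, of A t B, OF that(2)] by (simp add: Z_def)
  qed
  have bound: "a * q + i < m * q" if "a < m" "i < q" for a i
  proof -
    have "a * q + i < Suc a * q" using that by simp
    also have "\<dots> \<le> m * q" using that by (intro mult_right_mono) auto
    finally show ?thesis .
  qed
  have "\<phi> ` Z \<subseteq> {..<m * q} \<times> {..<m * q}"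
    using P_sub t_sub by (fastforce simp: Z_def \<phi>_def intro!: bound)
  moreover have "card (\<phi> ` Z) = m * q * k"
  proof -
    have "\<forall>p\<in>P. finite (t p)"
      using t_sub finite_subset by blast
    then have "card (\<phi> ` Z) = (\<Sum>p\<in>P. card (t p))"
      using \<open>finite P\<close> card_image[OF \<open>inj_on \<phi> Z\<close>] by (simp add: Z_def)
    then show ?thesis by (simp add: card_t card_P)
  qed
  moreover have "card {p \<in> \<phi> ` Z. fst p = i} = k" if "i < m * q" for i
  proof -
    have *: "i div q < m" "i mod q < q"
      using that by (auto simp: less_mult_imp_div_less intro!: mod_less_divisor gr0I)
    have "card {p \<in> \<phi> ` Z. fst p = i} = card {p \<in> P. fst p = i div q}"
    proof (rule fibre[where B = "\<lambda>_ x. fst x = i mod q"])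
      fix z assume "z \<in> Z"
      then show "fst (\<phi> z) = i \<longleftrightarrow> fst (fst z) = i div q \<and> fst (snd z) = i mod q"
        using decode(1,2)[of z] by (metis div_mult_mod_eq)
    qed (use t_row *(2) in simp)
    also have "\<dots> = k"
      using P *(1) unfolding k_transversal_def by blast
    finally show ?thesis .
  qed
  moreover have "card {p \<in> \<phi> ` Z. snd p = j} = k" if "j < m * q" for j
  proof -
    have *: "j div q < m" "j mod q < q"
      using that by (auto simp: less_mult_imp_div_less intro!: mod_less_divisor gr0I)
    have "card {p \<in> \<phi> ` Z. snd p = j} = card {p \<in> P. snd p = j div q}"
    proof (rule fibre[where B = "\<lambda>_ x. snd x = j mod q"])
      fix z assume "z \<in> Z"
      then show "snd (\<phi> z) = j \<longleftrightarrow> snd (fst z) = j div q \<and> snd (snd z) = j mod q"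
        using decode(3,4)[of z] by (metis div_mult_mod_eq)
    qed (use t_col *(2) in simp)
    also have "\<dots> = k"
      using P *(1) unfolding k_transversal_def by blast
    finally show ?thesis .
  qed
  moreover have "card {p \<in> \<phi> ` Z. L (fst p) (snd p) = s} = k" if "s \<in> S" for s
  proof -
    obtain c where "c < m" and c: "\<And>a b. a < m \<Longrightarrow> b < m \<Longrightarrow>
        s \<in> symbols q (block q L a b) \<longleftrightarrow> (a + b) mod m = c"
      using q_step_type_symbol_class[OF step \<open>s \<in> S\<close>] by blast
    have "card {p \<in> \<phi> ` Z. L (fst p) (snd p) = s} = card {p \<in> P. (fst p + snd p) mod m = c}"
    proof (rule fibre[where B = "\<lambda>p x. block q L (fst p) (snd p) (fst x) (snd x) = s"])
      fix z assume "z \<in> Z"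
      then obtain a b i j where z: "z = ((a, b), (i, j))" "a < m" "b < m" "i < q" "j < q"
        using P_sub t_sub by (fastforce simp: Z_def)
      \<comment> \<open>An entry equal to \<open>s\<close> puts \<open>s\<close> among the symbols
        of its block, which forces the block into the class \<open>c\<close>.\<close>
      have "block q L a b i j \<in> symbols q (block q L a b)"
        using z by (auto simp: symbols_def)
      then show "L (fst (\<phi> z)) (snd (\<phi> z)) = s \<longleftrightarrow> (fst (fst z) + snd (fst z)) mod m = c \<and>
          block q L (fst (fst z)) (snd (fst z)) (fst (snd z)) (snd (snd z)) = s"
        using z c[of a b] by (auto simp: \<phi>_def block_def)
    next
      fix p assume "p \<in> P" "(fst p + snd p) mod m = c"
      then show "card {x \<in> t p. block q L (fst p) (snd p) (fst x) (snd x) = s} = 1"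
        using P_sub c[of "fst p" "snd p"] by (intro t_sym) auto
    qed
    also have "\<dots> = k"
      using P \<open>c < m\<close> unfolding k_transversal_def by blast
    finally show ?thesis .
  qed
  ultimately have "k_transversal S (m * q) L k (\<phi> ` Z)"
    unfolding k_transversal_def by blast
  then show ?thesis ..
qed

theorem theorem4p2:
  fixes m q n :: nat and S :: "'a set" and L :: "nat \<Rightarrow> nat \<Rightarrow> 'a"
  assumes "m > 0" and "even m"
    and "q > 0" and "odd q"
    and "n = m * q"
    and "q_step_type S m q L"
    and "\<And>a b. a < m \<Longrightarrow> b < m \<Longrightarrow>
           cyclic_latin_square (symbols q (block q L a b)) q (block q L a b)"
  shows "\<exists>T. k_transversal S n L 2 T"
proof -
  obtain P where P: "k_transversal {..<m} m (\<lambda>a b. (a + b) mod m) 2 P"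
    using even_addition_table_2_transversal assms(1,2) by blast
  \<comment> \<open>The transversals are chosen block by block; even blocks with the same symbols
    may be different squares.\<close>
  define t where "t = (\<lambda>(a, b). SOME T. k_transversal (symbols q (block q L a b)) q (block q L a b) 1 T)"
  have "k_transversal (symbols q (block q L a b)) q (block q L a b) 1 (t (a, b))"
    if "a < m" "b < m" for a b
    using odd_cyclic_latin_square_transversal[OF assms(7)[OF that] \<open>odd q\<close>]
    by (auto simp: t_def intro: someI_ex)
  then show ?thesis
    using q_step_type_inflate_transversal[OF assms(6) P] assms(5) by blast
qed

end
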